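(* Let $\beta\in(-2,-1)$, $c\in(0,1)$, and let $n\geq 3$ be an integer with $n-1>\frac{\beta}{c-1}$. Assume that $M_n(x;\beta,c)$ and $M_{n-1}(x;\beta,c)$ have no common zeros. For $m\in\{n-1,n\}$ let $x_{1,m}<x_{2,m}<\dots<x_{m,m}$ denote the zeros of the monic Meixner polynomial $M_m(x;\beta,c)$. Then the $n$ zeros of $(x+\beta)M_{n-1}(x;\beta,c)$ interlace with the $n+1$ zeros of $(x+\beta+1)M_n(x;\beta,c)$ as follows: $$0<x_{1,n}<x_{1,n-1}<-\beta-1<x_{2,n-1}<x_{2,n}<-\beta<x_{3,n},$$ and, for each $k\in\{3,\dots,n-1\}$, $x_{k,n}<x_{k,n-1}<x_{k+1,n}$.
   Context: Monic Meixner polynomials are defined by $$M_n(x;\beta,c)=\left(\frac{c}{c-1}\right)^n(\beta)_n\sum_{k=0}^{n}\frac{(-n)_k(-x)_k(1-\frac1c)^k}{(\beta)_k\,k!},$$ for real $\beta,c$ with $c\neq 0$ and $\beta\notin\{-1,-2,\dots,-n+1\}$, where $(\alpha)_0=1$ and $(\alpha)_k=\alpha(\alpha+1)\cdots(\alpha+k-1)$ for $k\geq1$. For $\beta\in(-2,-1)$, $c\in(0,1)$ and $m>\frac{\beta}{c-1}$, the zeros of $M_m(x;\beta,c)$ are real, simple and positive. *)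

theory Defs
  imports "HOL-Analysis.Analysis"
begin

definition meixner :: "nat \<Rightarrow> real \<Rightarrow> real \<Rightarrow> real \<Rightarrow> real" where
  "meixner n \<beta> c x =
     (c / (c - 1)) ^ n * pochhammer \<beta> n *
     (\<Sum>k=0..n. pochhammer (- real n) k * pochhammer (- x) k * (1 - 1 / c) ^ k
                 / (pochhammer \<beta> k * fact k))"

end

theory Submission
  imports Defs "HOL-Computational_Algebra.Polynomial"
begin

text \<open>
  For \<open>\<beta> \<in> (-2, -1)\<close> the polynomials are still orthogonal with respect to the weight \<open>c\<^sup>k (\<beta>)\<^sub>k / k!\<close>
  on \<open>k = 0, 1, 2, \<dots>\<close>, which is negative at \<open>k = 1\<close> and positive elsewhere. Write \<open>L\<close> for the
  corresponding functional.

  Explicit values show that \<open>(-1)\<^sup>n M\<^sub>n\<close> is positive at \<open>0\<close> and \<open>1\<close> and negative at \<open>-\<beta> - 1\<close>, so there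
  are zeros \<open>x\<^sub>1\<close> in \<open>(0, -\<beta> - 1)\<close> and \<open>x\<^sub>2\<close> in \<open>(-\<beta> - 1, 1)\<close>. If another zero \<open>z\<close> were at most \<open>2\<close>,
  then \<open>x (x - 1)\<close> times the linear factors of the zeros other than \<open>x\<^sub>1, x\<^sub>2, z\<close> would have
  degree less than \<open>n\<close> but not be orthogonal to \<open>M\<^sub>n\<close>, as \<open>x (x - 1)\<close> kills the weights at \<open>0\<close> and \<open>1\<close>.

  If \<open>M\<^sub>n = (x - x\<^sub>j) P\<close>, then \<open>L (P q) M\<^bsub>n-1\<^esub>(x\<^sub>j) = q(x\<^sub>j) h\<^bsub>n-1\<^esub>\<close> for \<open>q\<close> of degree at most \<open>n\<close>, where
  \<open>h\<^bsub>n-1\<^esub> > 0\<close>. Choosing \<open>q\<close> with \<open>L (P q) > 0\<close>, namely \<open>(x - 1) \<Prod>\<^bsub>i\<ge>3\<^esub> (x - x\<^sub>i)\<close> for \<open>j = 1, 2\<close> and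
  \<open>x (x - 1) \<Prod>\<^bsub>i\<ge>3, i\<noteq>j\<^esub> (x - x\<^sub>i)\<close> for \<open>j \<ge> 3\<close>, gives the sign of \<open>M\<^bsub>n-1\<^esub>\<close> at every zero of \<open>M\<^sub>n\<close>. Together
  with its sign at \<open>-\<beta> - 1\<close> this exhibits \<open>n - 1\<close> sign changes in the required places.
\<close>

section \<open>Weight, functional and polynomials\<close>

definition meixner_weight :: "real \<Rightarrow> real \<Rightarrow> nat \<Rightarrow> real" where
  "meixner_weight \<beta> c k = c ^ k * pochhammer \<beta> k / fact k"

definition meixner_functional :: "real \<Rightarrow> real \<Rightarrow> real poly \<Rightarrow> real" where
  "meixner_functional \<beta> c q = (\<Sum>k. meixner_weight \<beta> c k * poly q (real k))"

text \<open>Recast as a \<open>poly\<close> so that degrees, roots and factorizations are available.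
  The product of the \<open>[:real i, -1:]\<close> evaluates to \<open>pochhammer (- x) k\<close>,
  and the sign of \<open>pochhammer (- real n) k\<close> is absorbed into the power of
  \<open>(1 - c) / c\<close>.\<close>

definition meixner_poly :: "nat \<Rightarrow> real \<Rightarrow> real \<Rightarrow> real poly" where
  "meixner_poly n \<beta> c = smult ((c / (c - 1)) ^ n * pochhammer \<beta> n)
     (\<Sum>k\<le>n. smult (real (n choose k) * ((1 - c) / c) ^ k / pochhammer \<beta> k)
                  (\<Prod>i<k. [:real i, -1:]))"

text \<open>The value of the functional on the square of \<open>meixner_poly n \<beta> c\<close>,
  when \<open>0 < c < 1\<close> and no \<open>pochhammer \<beta> k\<close> vanishes; see
  \<open>meixner_orthogonality\<close>.\<close>

definition meixner_norm :: "nat \<Rightarrow> real \<Rightarrow> real \<Rightarrow> real" where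
  "meixner_norm n \<beta> c =
     (c / (1 - c)) ^ n * pochhammer \<beta> n * (1 - c) powr (- \<beta> - real n) * fact n"

section \<open>Polynomial form, leading coefficients and factorization over the roots\<close>

lemma pochhammer_neg_of_nat_over_fact:
  "pochhammer (- real n) k / fact k = (-1) ^ k * real (n choose k)"
proof -
  have "real n gchoose k = (-1) ^ k * pochhammer (- real n) k / fact k"
    by (rule gbinomial_pochhammer)
  hence "(-1) ^ k * real (n choose k) = (-1) ^ k * ((-1) ^ k * pochhammer (- real n) k / fact k)"
    by (simp add: binomial_gbinomial)
  also have "\<dots> = ((-1) ^ k * (-1) ^ k) * (pochhammer (- real n) k / fact k)" by simp
  also have "((-1) ^ k * (-1) ^ k :: real) = 1" by (simp flip: power_mult_distrib)
  finally show ?thesis by simp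
qed

lemma meixner_altdef:
  "meixner n \<beta> c x = (c / (c - 1)) ^ n * pochhammer \<beta> n *
     (\<Sum>k\<le>n. real (n choose k) * (1 / c - 1) ^ k * pochhammer (- x) k / pochhammer \<beta> k)"
proof -
  have "pochhammer (- real n) k * pochhammer (- x) k * (1 - 1 / c) ^ k / (pochhammer \<beta> k * fact k)
      = real (n choose k) * (1 / c - 1) ^ k * pochhammer (- x) k / pochhammer \<beta> k" for k
  proof -
    have "pochhammer (- real n) k * pochhammer (- x) k * (1 - 1 / c) ^ k / (pochhammer \<beta> k * fact k)
      = (pochhammer (- real n) k / fact k) * pochhammer (- x) k * (1 - 1 / c) ^ k / pochhammer \<beta> k"
      by simp
    also have "\<dots> = real (n choose k) * ((-1) ^ k * (1 - 1 / c) ^ k) * pochhammer (- x) k / pochhammer \<beta> k"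
      by (subst pochhammer_neg_of_nat_over_fact) (simp add: mult_ac)
    also have "(-1) ^ k * (1 - 1 / c) ^ k = (1 / c - 1) ^ k"
      by (simp flip: power_mult_distrib)
    finally show ?thesis .
  qed
  thus ?thesis by (simp add: meixner_def atMost_atLeast0)
qed

lemma poly_meixner_poly:
  assumes "c \<noteq> 0"
  shows "poly (meixner_poly n \<beta> c) x = meixner n \<beta> c x"
proof -
  have "(1 - c) / c = 1 / c - 1" using assms by (simp add: field_simps)
  moreover have "poly (\<Prod>i<k. [:real i, -1:]) x = pochhammer (- x) k" for k
    by (auto simp: poly_prod pochhammer_prod atLeast0LessThan intro!: prod.cong)
  ultimately show ?thesis
    by (simp add: meixner_poly_def meixner_altdef poly_sum mult_ac)
qed

lemma degree_prod_linear: "degree (\<Prod>i\<in>A. [:a i, 1:] :: real poly) = card A"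
  by (cases "finite A") (simp_all add: degree_prod_eq_sum_degree)

lemma lead_coeff_prod_linear: "lead_coeff (\<Prod>i\<in>A. [:a i, 1:] :: real poly) = 1"
  by (simp add: lead_coeff_prod)

lemma degree_coeff_falling:
  shows "degree (\<Prod>i<k. [:real i, -1:]) = k" and "coeff (\<Prod>i<k. [:real i, -1:]) k = (-1) ^ k"
proof -
  show deg: "degree (\<Prod>i<k. [:real i, -1:]) = k"
    by (simp add: degree_prod_eq_sum_degree)
  have "lead_coeff (\<Prod>i<k. [:real i, -1:]) = (-1) ^ k"
    by (simp add: lead_coeff_prod)
  thus "coeff (\<Prod>i<k. [:real i, -1:]) k = (-1) ^ k" by (simp add: deg)
qed

text \<open>Only the summand \<open>k = n\<close> reaches degree \<open>n\<close>; its sign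
  \<open>(-1) ^ n\<close> and the powers of \<open>(1 - c) / c\<close> and
  \<open>c / (c - 1)\<close> multiply to 1.\<close>

lemma meixner_poly_monic:
  assumes "0 < c" "c < 1" and nz: "\<And>k. pochhammer \<beta> k \<noteq> 0"
  shows "degree (meixner_poly n \<beta> c) = n" and "lead_coeff (meixner_poly n \<beta> c) = 1"
proof -
  have "coeff (\<Sum>k\<le>n. smult (real (n choose k) * ((1 - c) / c) ^ k / pochhammer \<beta> k)
                  (\<Prod>i<k. [:real i, -1:])) n
      = (\<Sum>k\<in>{n}. real (n choose k) * ((1 - c) / c) ^ k / pochhammer \<beta> k * (-1) ^ n)"
    unfolding coeff_sum
    by (rule sum.mono_neutral_cong_right)
       (auto simp: degree_coeff_falling intro!: coeff_eq_0)
  hence "coeff (meixner_poly n \<beta> c) n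
      = ((c / (c - 1)) ^ n * ((1 - c) / c) ^ n * (-1) ^ n) * (pochhammer \<beta> n / pochhammer \<beta> n)"
    by (simp add: meixner_poly_def)
  also have "(c / (c - 1)) ^ n * ((1 - c) / c) ^ n * (-1) ^ n = ((c / (c - 1)) * ((1 - c) / c) * (-1)) ^ n"
    by (simp only: power_mult_distrib)
  also have "(c / (c - 1)) * ((1 - c) / c) * (-1) = 1" using assms by (simp add: field_simps)
  finally have coeff: "coeff (meixner_poly n \<beta> c) n = 1" using nz by simp
  have "degree (meixner_poly n \<beta> c) \<le> n"
    unfolding meixner_poly_def
    by (intro order.trans[OF degree_smult_le] degree_sum_le)
       (auto intro: order.trans[OF degree_smult_le] simp: degree_coeff_falling)
  moreover have "n \<le> degree (meixner_poly n \<beta> c)" using coeff by (intro le_degree) simp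
  ultimately show "degree (meixner_poly n \<beta> c) = n" by simp
  thus "lead_coeff (meixner_poly n \<beta> c) = 1" using coeff by simp
qed

text \<open>The leading terms cancel in the difference of the two sides, which would then have more
  roots than its degree allows.\<close>

lemma monic_poly_eq_prod_roots:
  fixes p :: "real poly"
  assumes fin: "finite A" and inj: "inj_on r A" and "degree p = card A" "lead_coeff p = 1"
    and root: "\<And>i. i \<in> A \<Longrightarrow> poly p (r i) = 0"
  shows "p = (\<Prod>i\<in>A. [:- r i, 1:])"
proof (rule ccontr)
  let ?q = "\<Prod>i\<in>A. [:- r i, 1:]"
  assume neq: "p \<noteq> ?q"
  have "coeff (p - ?q) (card A) = 0"
    using assms lead_coeff_prod_linear[of "\<lambda>i. - r i" A] by (simp add: degree_prod_linear)
  moreover have "degree (p - ?q) \<le> card A"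
    using assms by (intro degree_diff_le) (simp_all add: degree_prod_linear)
  ultimately have "degree (p - ?q) < card A"
    using neq by (metis eq_iff_diff_eq_0 le_neq_implies_less leading_coeff_0_iff)
  moreover have "card (r ` A) \<le> card {x. poly (p - ?q) x = 0}"
    using neq root fin by (intro card_mono poly_roots_finite) (auto simp: poly_prod)
  moreover have "card {x. poly (p - ?q) x = 0} \<le> degree (p - ?q)"
    using neq by (intro card_poly_roots_bound) simp
  ultimately show False using inj by (simp add: card_image)
qed

section \<open>Rising factorials, finite differences and moments of the weight\<close>

text \<open>Subtracting a multiple of the monic rising factorial of top degree lowers the degree
  bound. The clause on \<open>a d\<close> later supplies the constant in the orthogonality
  relation.\<close>

lemma poly_rising_expansion:
  fixes q :: "real poly"
  assumes "degree q \<le> d"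
  shows "\<exists>a. a d = coeff q d \<and> (\<forall>x. poly q x = (\<Sum>j\<le>d. a j * pochhammer (\<beta> + x) j))"
  using assms
proof (induction d arbitrary: q)
  case 0
  thus ?case by (intro exI[of _ "\<lambda>_. coeff q 0"]) (auto elim!: degree_eq_zeroE)
next
  case (Suc d)
  let ?P = "\<Prod>i\<in>{..<Suc d}. [:\<beta> + real i, 1:]"
  have P: "poly ?P x = pochhammer (\<beta> + x) (Suc d)" for x
    by (auto simp: poly_prod pochhammer_prod atLeast0LessThan add_ac simp del: prod.lessThan_Suc intro!: prod.cong)
  have degP: "degree ?P = Suc d" by (subst degree_prod_linear) simp
  have lcP: "coeff ?P (Suc d) = 1"
    using lead_coeff_prod_linear[of "\<lambda>i. \<beta> + real i" "{..<Suc d}"] unfolding degP .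
  let ?q = "q - smult (coeff q (Suc d)) ?P"
  have "degree ?q \<le> Suc d"
    using Suc.prems by (intro degree_diff_le order.trans[OF degree_smult_le]) (simp_all add: degP del: prod.lessThan_Suc)
  moreover have "coeff ?q (Suc d) = 0" by (simp only: coeff_diff coeff_smult lcP)
  ultimately have "degree ?q \<le> d"
    by (metis degree_0 le_SucE leading_coeff_0_iff zero_le)
  from Suc.IH[OF this] obtain a where a: "\<And>x. poly ?q x = (\<Sum>j\<le>d. a j * pochhammer (\<beta> + x) j)"
    by blast
  have "poly q x = (\<Sum>j\<le>Suc d. (a(Suc d := coeff q (Suc d))) j * pochhammer (\<beta> + x) j)" for x
  proof -
    have "poly q x = poly ?q x + coeff q (Suc d) * pochhammer (\<beta> + x) (Suc d)"
      by (simp add: P del: prod.lessThan_Suc)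
    thus ?thesis unfolding a by simp
  qed
  thus ?case by (intro exI[of _ "a(Suc d := coeff q (Suc d))"]) simp
qed

text \<open>Up to sign this is an n-th finite difference of a polynomial of degree \<open>j\<close>.
  Pascal's rule turns the step in \<open>n\<close> into a difference in \<open>a\<close>, and
  differencing a rising factorial lowers its length by one.\<close>

lemma alternating_sum_pochhammer:
  fixes a :: real
  assumes "j \<le> n"
  shows "(\<Sum>k\<le>n. (-1) ^ k * real (n choose k) * pochhammer (a + real k) j)
       = (if j = n then (-1) ^ n * fact n else 0)"
  using assms
proof (induction n arbitrary: j a)
  case 0
  thus ?case by simp
next
  case (Suc n)
  define S where "S = (\<lambda>j a. \<Sum>k\<le>n. (-1) ^ k * real (n choose k) * pochhammer (a + real k) j)"
  have "(\<Sum>k\<le>Suc n. (-1) ^ k * real (Suc n choose k) * pochhammer (a + real k) j)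
     = pochhammer a j + (\<Sum>k\<le>n. (-1) ^ Suc k * real (Suc n choose Suc k) * pochhammer (a + real (Suc k)) j)"
    by (subst sum.atMost_Suc_shift) simp
  also have "\<dots> = pochhammer a j + (\<Sum>k\<le>n. (-1) ^ Suc k * real (n choose Suc k) * pochhammer (a + real (Suc k)) j)
      - S j (a + 1)"
    unfolding S_def by (simp add: distrib_left distrib_right left_diff_distrib sum_negf sum_subtractf add_ac)
  also have "pochhammer a j + (\<Sum>k\<le>n. (-1) ^ Suc k * real (n choose Suc k) * pochhammer (a + real (Suc k)) j)
     = (\<Sum>k\<le>Suc n. (-1) ^ k * real (n choose k) * pochhammer (a + real k) j)"
    by (subst sum.atMost_Suc_shift) simp
  also have "\<dots> = S j a" by (simp add: S_def)
  finally have rec: "(\<Sum>k\<le>Suc n. (-1) ^ k * real (Suc n choose k) * pochhammer (a + real k) j)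
     = S j a - S j (a + 1)" .
  show ?case
  proof (cases j)
    case 0
    thus ?thesis unfolding rec by (simp add: S_def)
  next
    case (Suc i)
    have poch: "pochhammer b (Suc i) - pochhammer (b + 1) (Suc i) = - real (Suc i) * pochhammer (b + 1) i" for b :: real
    proof -
      have "pochhammer b (Suc i) = b * pochhammer (b + 1) i" by (rule pochhammer_rec)
      moreover have "pochhammer (b + 1) (Suc i) = pochhammer (b + 1) i * (b + 1 + real i)"
        by (rule pochhammer_Suc)
      ultimately show ?thesis by (simp add: algebra_simps)
    qed
    have "S j a - S j (a + 1) = (\<Sum>k\<le>n. (-1) ^ k * real (n choose k) *
        (pochhammer (a + real k) (Suc i) - pochhammer (a + real k + 1) (Suc i)))"
      unfolding S_def Suc by (simp add: sum_subtractf algebra_simps)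
    also have "\<dots> = - real (Suc i) * S i (a + 1)"
      unfolding poch S_def by (simp add: sum_distrib_left mult_ac add_ac)
    also have "S i (a + 1) = (if i = n then (-1) ^ n * fact n else 0)"
      unfolding S_def using Suc.prems Suc by (intro Suc.IH) simp
    finally show ?thesis unfolding rec using Suc by (auto simp: algebra_simps)
  qed
qed

text \<open>Newton's binomial series with exponent \<open>- a\<close> at \<open>- c\<close>.\<close>

lemma pochhammer_series_sums:
  fixes a c :: real
  assumes "0 < c" "c < 1"
  shows "(\<lambda>k. c ^ k * pochhammer a k / fact k) sums (1 - c) powr (- a)"
proof -
  have "(\<lambda>k. (- a gchoose k) * (- c) ^ k) sums (1 + (- c)) powr (- a)"
    using assms by (intro gen_binomial_real) auto
  moreover have "(- a gchoose k) * (- c) ^ k = c ^ k * pochhammer a k / fact k" for k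
  proof -
    have "(- a gchoose k) * (- c) ^ k = ((-1) ^ k * (- c) ^ k) * pochhammer a k / fact k"
      by (simp add: gbinomial_pochhammer)
    also have "(-1) ^ k * (- c) ^ k = c ^ k" by (simp flip: power_mult_distrib)
    finally show ?thesis .
  qed
  ultimately show ?thesis by simp
qed

text \<open>The falling factorial kills the terms with index below \<open>k\<close>. After a shift
  by \<open>k\<close>, the rising factorials merge and leave the binomial series with parameter
  \<open>\<beta> + real (k + j)\<close>.\<close>

lemma meixner_weight_moments:
  assumes c: "0 < c" "c < 1"
  shows "(\<lambda>x. meixner_weight \<beta> c x * ((-1) ^ k * pochhammer (- real x) k) * pochhammer (\<beta> + real x) j)
     sums (c ^ k * pochhammer \<beta> (k + j) * (1 - c) powr (- (\<beta> + real (k + j))))" (is "?f sums ?s")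
proof -
  have "(\<lambda>y. c ^ k * pochhammer \<beta> (k + j) *
        (c ^ y * pochhammer (\<beta> + real (k + j)) y / fact y)) sums ?s"
    using pochhammer_series_sums[OF c] by (intro sums_mult)
  moreover have "c ^ k * pochhammer \<beta> (k + j) * (c ^ y * pochhammer (\<beta> + real (k + j)) y / fact y)
       = ?f (y + k)" for y
  proof -
    have ff: "(-1) ^ k * pochhammer (- real (y + k)) k = fact (y + k) / fact y"
    proof -
      have "fact k * (real (y + k) gchoose k) = (-1) ^ k * pochhammer (- real (y + k)) k"
        by (simp add: gbinomial_pochhammer)
      moreover have "real (y + k) gchoose k = fact (y + k) / (fact k * fact y)"
        by (simp add: binomial_fact flip: binomial_gbinomial of_nat_add)
      ultimately show ?thesis by simp
    qed
    have "pochhammer \<beta> (k + j) * pochhammer (\<beta> + real (k + j)) y = pochhammer \<beta> (k + j + y)"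
      by (rule pochhammer_product'[symmetric])
    also have "\<dots> = pochhammer \<beta> ((y + k) + j)" by (simp add: add_ac)
    also have "\<dots> = pochhammer \<beta> (y + k) * pochhammer (\<beta> + real (y + k)) j"
      by (rule pochhammer_product')
    finally show ?thesis unfolding ff by (simp add: meixner_weight_def power_add mult_ac)
  qed
  ultimately have "(\<lambda>y. ?f (y + k)) sums ?s" by simp
  moreover have "(\<Sum>y<k. ?f y) = 0"
    by (intro sum.neutral) (auto simp: pochhammer_of_nat_eq_0_iff)
  ultimately show ?thesis using sums_iff_shift[of ?f k ?s] by simp
qed

lemma meixner_weight_summable:
  assumes c: "0 < c" "c < 1"
  shows "summable (\<lambda>k. meixner_weight \<beta> c k * poly q (real k))"
proof -
  obtain a where a: "\<And>x. poly q x = (\<Sum>j\<le>degree q. a j * pochhammer (\<beta> + x) j)"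
    using poly_rising_expansion[of q "degree q" \<beta>] by auto
  have "summable (\<lambda>k. \<Sum>j\<le>degree q. a j * (meixner_weight \<beta> c k * pochhammer (\<beta> + real k) j))"
    using sums_summable[OF meixner_weight_moments[OF c, of \<beta> 0]]
    by (intro summable_sum summable_mult) simp
  thus ?thesis by (simp add: a sum_distrib_left mult_ac)
qed

section \<open>Values at 0 and 1\<close>

lemma meixner_at_0: "meixner n \<beta> c 0 = (c / (c - 1)) ^ n * pochhammer \<beta> n"
proof -
  have "(\<Sum>k\<le>n. real (n choose k) * (1 / c - 1) ^ k * pochhammer (- 0) k / pochhammer \<beta> k)
      = (\<Sum>k\<in>{0}. real (n choose k) * (1 / c - 1) ^ k * pochhammer (- 0) k / pochhammer \<beta> k)"
    by (rule sum.mono_neutral_right) (auto simp: pochhammer_0_left)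
  thus ?thesis unfolding meixner_altdef by simp
qed

lemma meixner_at_1:
  "meixner n \<beta> c 1 = (c / (c - 1)) ^ n * pochhammer \<beta> n * (1 - real n * (1 / c - 1) / \<beta>)"
proof -
  let ?f = "\<lambda>k. real (n choose k) * (1 / c - 1) ^ k * pochhammer (- 1) k / pochhammer \<beta> k"
  have "sum ?f {..n} = 1 - real n * (1 / c - 1) / \<beta>"
  proof (cases "n = 0")
    case False
    have "sum ?f {..n} = sum ?f {0, 1}"
    proof (rule sum.mono_neutral_right)
      show "\<forall>k\<in>{..n} - {0, 1}. ?f k = 0"
        using pochhammer_of_nat_eq_0_iff[of 1, where 'a = real] by auto
    qed (use False in auto)
    thus ?thesis by simp
  qed simp
  thus ?thesis unfolding meixner_altdef by simp
qed

section \<open>Orthogonality, quadrature and the value at \<open>- \<beta> - 1\<close>\<close>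

context
  fixes \<beta> c :: real
  assumes c: "0 < c" "c < 1"
begin

lemma meixner_functional_add:
  "meixner_functional \<beta> c (p + q) = meixner_functional \<beta> c p + meixner_functional \<beta> c q"
  unfolding meixner_functional_def
  by (subst suminf_add[OF meixner_weight_summable[OF c] meixner_weight_summable[OF c]])
     (simp add: algebra_simps)

lemma meixner_functional_smult:
  "meixner_functional \<beta> c (smult a q) = a * meixner_functional \<beta> c q"
  unfolding meixner_functional_def
  by (subst suminf_mult[symmetric, OF meixner_weight_summable[OF c]]) (simp add: mult_ac)

lemma meixner_functional_pos:
  assumes "\<And>k. 0 \<le> meixner_weight \<beta> c k * poly q (real k)"
    and "0 < meixner_weight \<beta> c i * poly q (real i)"
  shows "0 < meixner_functional \<beta> c q"
  unfolding meixner_functional_def using assms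
  by (intro suminf_pos2[OF meixner_weight_summable[OF c]])

text \<open>Expanding \<open>M\<^sub>n\<close> in falling and \<open>q\<close> in rising factorials turns the functional into an \<open>n\<close>-th
  finite difference of \<open>(\<beta> + k)\<^sub>j\<close>.\<close>

lemma meixner_orthogonality:
  assumes nz: "\<And>k. pochhammer \<beta> k \<noteq> 0" and deg: "degree q \<le> n"
  shows "meixner_functional \<beta> c (meixner_poly n \<beta> c * q) = coeff q n * meixner_norm n \<beta> c"
proof -
  obtain a where an: "a n = coeff q n"
    and a: "\<And>x. poly q x = (\<Sum>j\<le>n. a j * pochhammer (\<beta> + x) j)"
    using poly_rising_expansion[OF deg, of \<beta>] by auto
  define C where "C = (c / (c - 1)) ^ n * pochhammer \<beta> n"
  define b where "b = (\<lambda>k. real (n choose k) * (1 / c - 1) ^ k / pochhammer \<beta> k * (-1) ^ k)"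
  define s where "s = (\<lambda>k j. c ^ k * pochhammer \<beta> (k + j) * (1 - c) powr (- (\<beta> + real (k + j))))"
  have "(\<lambda>x. \<Sum>j\<le>n. \<Sum>k\<le>n. (C * a j * b k) * (meixner_weight \<beta> c x *
           ((-1) ^ k * pochhammer (- real x) k) * pochhammer (\<beta> + real x) j))
        sums (\<Sum>j\<le>n. \<Sum>k\<le>n. (C * a j * b k) * s k j)"
    unfolding s_def by (intro sums_sum sums_mult meixner_weight_moments c)
  moreover have "(\<Sum>j\<le>n. \<Sum>k\<le>n. (C * a j * b k) * (meixner_weight \<beta> c x *
           ((-1) ^ k * pochhammer (- real x) k) * pochhammer (\<beta> + real x) j))
       = meixner_weight \<beta> c x * poly (meixner_poly n \<beta> c * q) (real x)" for x
  proof -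
    have sg: "(-1) ^ k * ((-1) ^ k * y) = (y :: real)" for k y
      by (simp flip: power_mult_distrib mult.assoc)
    have "meixner n \<beta> c (real x) = C * (\<Sum>k\<le>n. b k * ((-1) ^ k * pochhammer (- real x) k))"
      unfolding meixner_altdef C_def b_def by (simp add: sg mult.assoc)
    hence "meixner_weight \<beta> c x * poly (meixner_poly n \<beta> c * q) (real x)
      = meixner_weight \<beta> c x * (C * (\<Sum>k\<le>n. b k * ((-1) ^ k * pochhammer (- real x) k)) *
          (\<Sum>j\<le>n. a j * pochhammer (\<beta> + real x) j))"
      using c by (simp add: poly_meixner_poly a)
    also have "\<dots> = (\<Sum>k\<le>n. \<Sum>j\<le>n. (C * a j * b k) * (meixner_weight \<beta> c x *
           ((-1) ^ k * pochhammer (- real x) k) * pochhammer (\<beta> + real x) j))"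
      by (simp add: sum_distrib_left sum_distrib_right mult_ac)
    finally show ?thesis by (subst sum.swap) simp
  qed
  ultimately have "meixner_functional \<beta> c (meixner_poly n \<beta> c * q)
       = (\<Sum>j\<le>n. \<Sum>k\<le>n. (C * a j * b k) * s k j)"
    unfolding meixner_functional_def by (simp add: sums_iff)
  also have "\<dots> = (\<Sum>j\<le>n. C * a j * (1 - c) powr (- \<beta> - real j) *
      (\<Sum>k\<le>n. (-1) ^ k * real (n choose k) * pochhammer (\<beta> + real k) j))"
  proof -
    \<comment> \<open>The \<open>k\<close>-th powers of \<open>c\<close> and \<open>1 - c\<close>
      cancel, and \<open>pochhammer \<beta> (k + j)\<close> over \<open>pochhammer \<beta> k\<close>
      leaves the shifted factor, so the sum over \<open>k\<close> becomes the finite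
      difference.\<close>
    have "b k * s k j = (1 - c) powr (- \<beta> - real j) * ((-1) ^ k * real (n choose k) * pochhammer (\<beta> + real k) j)"
      for k j
    proof -
      have "(1 - c) powr (- (\<beta> + real (k + j))) = (1 - c) powr (- \<beta> - real j - real k)"
        by (simp add: algebra_simps)
      also have "\<dots> = (1 - c) powr (- \<beta> - real j) / (1 - c) ^ k"
        using c by (simp add: powr_diff powr_realpow)
      finally have pw: "(1 - c) powr (- (\<beta> + real (k + j))) = (1 - c) powr (- \<beta> - real j) / (1 - c) ^ k" .
      have "(1 / c - 1) ^ k * c ^ k / (1 - c) ^ k = ((1 / c - 1) * c / (1 - c)) ^ k"
        by (simp add: power_mult_distrib power_divide)
      also have "(1 / c - 1) * c / (1 - c) = 1" using c by (simp add: field_simps)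
      finally have one: "(1 / c - 1) ^ k * c ^ k / (1 - c) ^ k = 1" unfolding power_one .
      have "b k * s k j = ((1 / c - 1) ^ k * c ^ k / (1 - c) ^ k) * (pochhammer \<beta> k / pochhammer \<beta> k) *
         ((1 - c) powr (- \<beta> - real j) * ((-1) ^ k * real (n choose k) * pochhammer (\<beta> + real k) j))"
        unfolding b_def s_def pw pochhammer_product' by simp
      thus ?thesis unfolding one using nz by simp
    qed
    thus ?thesis by (simp add: sum_distrib_left mult.assoc)
  qed
  also have "\<dots> = (\<Sum>j\<le>n. if j = n then C * a j * (1 - c) powr (- \<beta> - real j) * ((-1) ^ n * fact n) else 0)"
    by (intro sum.cong refl) (simp add: alternating_sum_pochhammer)
  also have "\<dots> = C * a n * (1 - c) powr (- \<beta> - real n) * ((-1) ^ n * fact n)" by simp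
  also have "\<dots> = coeff q n * meixner_norm n \<beta> c"
  proof -
    have "(c / (c - 1)) ^ n * (-1) ^ n = (c / (c - 1) * (-1)) ^ n" by (simp only: power_mult_distrib)
    also have "c / (c - 1) * (-1) = c / (1 - c)" using c by (simp add: field_simps)
    finally have "(c / (1 - c)) ^ n = (c / (c - 1)) ^ n * (-1) ^ n" ..
    thus ?thesis by (simp add: C_def an meixner_norm_def)
  qed
  finally show ?thesis .
qed

text \<open>Modulo \<open>M\<^bsub>n+1\<^esub> = (x - t) P\<close>, the functional on \<open>P q\<close> only sees \<open>q t\<close>; taking \<open>q = M\<^sub>n\<close>
  identifies the constant.\<close>

lemma meixner_quadrature:
  assumes nz: "\<And>k. pochhammer \<beta> k \<noteq> 0"
    and P: "meixner_poly (Suc n) \<beta> c = [:- t, 1:] * P" and deg: "degree q \<le> Suc n"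
  shows "meixner_functional \<beta> c (P * q) * meixner n \<beta> c t = poly q t * meixner_norm n \<beta> c"
proof -
  have red: "meixner_functional \<beta> c (P * p) = poly p t * meixner_functional \<beta> c P"
    if "degree p \<le> Suc n" for p
  proof -
    have "poly (p - [:poly p t:]) t = 0" by simp
    then obtain s where s: "p - [:poly p t:] = [:- t, 1:] * s"
      unfolding poly_eq_0_iff_dvd by (elim dvdE)
    have "degree s \<le> n"
    proof (cases "s = 0")
      case False
      have "degree (p - [:poly p t:]) \<le> Suc n" using that by (intro degree_diff_le) auto
      thus ?thesis unfolding s using False by (subst (asm) degree_mult_eq) auto
    qed simp
    \<comment> \<open>The degree of \<open>s\<close> is below \<open>Suc n\<close>, so the
      coefficient picked out by orthogonality is zero.\<close>
    hence "meixner_functional \<beta> c (meixner_poly (Suc n) \<beta> c * s) = 0"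
      by (subst meixner_orthogonality[OF nz]) (auto simp: coeff_eq_0)
    moreover have "P * p = smult (poly p t) P + meixner_poly (Suc n) \<beta> c * s"
    proof -
      have "p = [:poly p t:] + [:- t, 1:] * s" using s by (simp add: algebra_simps)
      hence "P * p = P * [:poly p t:] + P * ([:- t, 1:] * s)" by (metis distrib_left)
      also have "P * [:poly p t:] = smult (poly p t) P" by simp
      finally show ?thesis unfolding P by (simp only: mult_ac)
    qed
    ultimately show ?thesis by (simp add: meixner_functional_add meixner_functional_smult)
  qed
  note monic = meixner_poly_monic[OF c nz]
  have "P \<noteq> 0" using P monic(2)[of "Suc n"] by auto
  hence degP: "degree P = n"
    using monic(1)[of "Suc n"] unfolding P by (subst (asm) degree_mult_eq) auto
  moreover have "lead_coeff P = 1"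
    using monic(2)[of "Suc n"] unfolding P by (simp add: lead_coeff_mult del: mult_pCons_left)
  ultimately have "meixner_functional \<beta> c (meixner_poly n \<beta> c * P) = meixner_norm n \<beta> c"
    by (subst meixner_orthogonality[OF nz]) auto
  moreover have "meixner_functional \<beta> c (P * meixner_poly n \<beta> c) = meixner n \<beta> c t * meixner_functional \<beta> c P"
    using c by (subst red) (simp_all add: monic poly_meixner_poly)
  ultimately have "meixner n \<beta> c t * meixner_functional \<beta> c P = meixner_norm n \<beta> c"
    by (simp add: mult.commute)
  thus ?thesis by (simp add: red[OF deg] mult.commute)
qed


context
  assumes nz: "\<And>k. pochhammer \<beta> k \<noteq> 0"
begin

text \<open>At this point the quotient of rising factorials collapses to
  \<open>1 + real k / \<beta>\<close>, which is linear in \<open>k\<close>; the sum is then a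
  binomial expansion plus a multiple of its derivative.\<close>

lemma meixner_at_neg_minus_1:
  "meixner n \<beta> c (- \<beta> - 1) = (1 / (c - 1)) ^ n * pochhammer \<beta> n * (1 + real n * (1 - c) / \<beta>)"
proof -
  have "\<beta> \<noteq> 0" using nz[of 1] by simp
  have "pochhammer (\<beta> + 1) k / pochhammer \<beta> k = 1 + real k / \<beta>" for k
  proof -
    have "\<beta> * pochhammer (\<beta> + 1) k = pochhammer \<beta> k * (\<beta> + real k)"
      by (metis pochhammer_Suc pochhammer_rec)
    thus ?thesis using nz[of k] \<open>\<beta> \<noteq> 0\<close> by (simp add: field_simps)
  qed
  hence "(\<Sum>k\<le>n. real (n choose k) * (1 / c - 1) ^ k * pochhammer (- (- \<beta> - 1)) k / pochhammer \<beta> k)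
      = (\<Sum>k\<le>n. real (n choose k) * (1 / c - 1) ^ k * (1 + real k / \<beta>))"
    by (simp add: mult.assoc add.commute[of \<beta>] flip: times_divide_eq_right)
  also have "\<dots> = (\<Sum>k\<le>n. real (n choose k) * (1 / c - 1) ^ k)
      + (1 / c - 1) / \<beta> * (\<Sum>k\<le>n. (real k * real (n choose k)) * (1 / c - 1) ^ (k - 1) * 1 ^ (n - k))"
  proof -
    have "real (n choose k) * d ^ k * (1 + real k / \<beta>) = real (n choose k) * d ^ k
       + d / \<beta> * ((real k * real (n choose k)) * d ^ (k - 1) * 1 ^ (n - k))" for k and d :: real
      by (cases k) (simp_all add: algebra_simps add_divide_distrib)
    thus ?thesis by (simp add: sum.distrib sum_distrib_left)
  qed
  also have "(\<Sum>k\<le>n. real (n choose k) * (1 / c - 1) ^ k) = (1 / c) ^ n"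
    using binomial_ring[of "1 / c - 1" 1 n] by simp
  also have "(\<Sum>k\<le>n. (real k * real (n choose k)) * (1 / c - 1) ^ (k - 1) * 1 ^ (n - k))
       = real n * (1 / c) ^ (n - 1)"
    by (subst binomial_deriv1) simp
  also have "(1 / c) ^ n + (1 / c - 1) / \<beta> * (real n * (1 / c) ^ (n - 1))
      = (1 / c) ^ n * (1 + real n * (1 - c) / \<beta>)"
  proof (cases n)
    case (Suc m)
    have "1 / c * e + (1 / c - 1) / \<beta> * (N * e) = 1 / c * e * (1 + N * (1 - c) / \<beta>)" for e N
      using c \<open>\<beta> \<noteq> 0\<close> by (simp add: field_simps)
    thus ?thesis unfolding Suc by simp
  qed simp
  finally have "meixner n \<beta> c (- \<beta> - 1)
      = ((c / (c - 1)) ^ n * (1 / c) ^ n) * pochhammer \<beta> n * (1 + real n * (1 - c) / \<beta>)"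
    unfolding meixner_altdef by simp
  also have "(c / (c - 1)) ^ n * (1 / c) ^ n = ((c / (c - 1)) * (1 / c)) ^ n"
    by (simp only: power_mult_distrib)
  also have "(c / (c - 1)) * (1 / c) = 1 / (c - 1)" using c by simp
  finally show ?thesis .
qed

end

end

section \<open>Signs of products and uniqueness of increasing enumerations\<close>

lemma prod_diff_sign:
  fixes x :: "'a \<Rightarrow> real"
  assumes "\<And>i. i \<in> A \<Longrightarrow> t < x i"
  shows "0 < (-1) ^ card A * (\<Prod>i\<in>A. t - x i)"
proof -
  have "(-1) ^ card A * (\<Prod>i\<in>A. t - x i) = (\<Prod>i\<in>A. x i - t)"
    by (simp flip: prod_constant prod.distrib)
  thus ?thesis using assms by (simp add: prod_pos)
qed

lemma strict_mono_on_image_unique: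
  fixes f g :: "nat \<Rightarrow> real"
  assumes f: "strict_mono_on {1..m} f" and g: "strict_mono_on {1..m} g"
    and img: "f ` {1..m} = g ` {1..m}" and k: "k \<in> {1..m}"
  shows "f k = g k"
  using k
proof (induction k rule: less_induct)
  case (less k)
  \<comment> \<open>Stated for arbitrary \<open>u\<close> and \<open>v\<close> so that both
    inequalities follow by exchanging the roles of \<open>f\<close> and \<open>g\<close>.\<close>
  have le: "v k \<le> u k"
    if u: "strict_mono_on {1..m} u" and v: "strict_mono_on {1..m} v" and uv: "u ` {1..m} = v ` {1..m}"
      and IH: "\<And>i. i < k \<Longrightarrow> i \<in> {1..m} \<Longrightarrow> u i = v i" for u v :: "nat \<Rightarrow> real"
  proof -
    obtain i where i: "i \<in> {1..m}" "u k = v i" using uv less.prems by blast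
    have "\<not> i < k"
    proof
      assume "i < k"
      hence "u i < u k" using strict_mono_onD[OF u i(1) less.prems] by simp
      thus False using IH[OF \<open>i < k\<close> i(1)] i(2) by simp
    qed
    thus ?thesis
      using strict_mono_onD[OF v less.prems i(1)] i(2) by (cases "k = i") auto
  qed
  show ?case
    using le[OF f g img] le[OF g f img[symmetric]] less.IH by (metis order.antisym)
qed

section \<open>Signs of the weight and of the polynomials for \<open>\<beta>\<close> between -2 and
  -1\<close>

context
  fixes \<beta> c :: real
  assumes beta: "-2 < \<beta>" "\<beta> < -1" and c: "0 < c" "c < 1"
begin

text \<open>The first two factors are negative and all later ones positive.\<close>

lemma pochhammer_pos_ge_2: "2 \<le> k \<Longrightarrow> 0 < pochhammer \<beta> k"
proof -
  assume "2 \<le> k"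
  then obtain j where k: "k = Suc (Suc j)" by (metis Suc_le_D numeral_2_eq_2 Suc_le_mono)
  have "pochhammer \<beta> k = \<beta> * ((\<beta> + 1) * pochhammer (\<beta> + 1 + 1) j)"
    unfolding k by (simp only: pochhammer_rec)
  moreover have "0 < pochhammer (\<beta> + 1 + 1) j" using beta by (intro Factorial.pochhammer_pos) simp
  ultimately show ?thesis using beta by (simp add: zero_less_mult_iff mult_less_0_iff)
qed

lemma pochhammer_nonzero: "pochhammer \<beta> k \<noteq> 0"
proof (cases "2 \<le> k")
  case True
  thus ?thesis using pochhammer_pos_ge_2[of k] by simp
next
  case False
  hence "k = 0 \<or> k = 1" by auto
  thus ?thesis using beta by auto
qed

text \<open>The sign condition on \<open>q\<close> is reversed at 1, where the weight is negative;
  the node \<open>K\<close> makes the inequality strict.\<close>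

lemma meixner_functional_pos_off_1:
  assumes "0 \<le> poly q 0" "poly q 1 \<le> 0" "\<And>k. 2 \<le> k \<Longrightarrow> 0 \<le> poly q (real k)"
    and "2 \<le> K" "0 < poly q (real K)"
  shows "0 < meixner_functional \<beta> c q"
proof (rule meixner_functional_pos[OF c])
  have pos: "0 < meixner_weight \<beta> c k" if "2 \<le> k" for k
    using pochhammer_pos_ge_2[OF that] c by (simp add: meixner_weight_def)
  show "0 \<le> meixner_weight \<beta> c k * poly q (real k)" for k
  proof (cases "2 \<le> k")
    case True
    thus ?thesis using pos assms(3) by (simp add: less_imp_le)
  next
    case False
    hence "k = 0 \<or> k = 1" by auto
    thus ?thesis
      using assms(1,2) beta c by (auto simp: meixner_weight_def mult_nonpos_nonpos mult_nonneg_nonpos)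
  qed
  show "0 < meixner_weight \<beta> c K * poly q (real K)" using pos assms by simp
qed

lemma meixner_norm_pos: "2 \<le> n \<Longrightarrow> 0 < meixner_norm n \<beta> c"
  using pochhammer_pos_ge_2[of n] c by (simp add: meixner_norm_def)

lemma meixner_signs:
  assumes n: "2 \<le> n" "\<beta> / (c - 1) < real n"
  shows "0 < (-1) ^ n * meixner n \<beta> c 0" "(-1) ^ n * meixner n \<beta> c (- \<beta> - 1) < 0"
    "0 < (-1) ^ n * meixner n \<beta> c 1"
proof -
  note nz = pochhammer_nonzero
  have sgn: "(-1) ^ n * ((a / (c - 1)) ^ n * y) = (a / (1 - c)) ^ n * y" for a y :: real
  proof -
    have "(-1) ^ n * ((a / (c - 1)) ^ n * y) = (-1 * (a / (c - 1))) ^ n * y"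
      by (simp only: power_mult_distrib mult.assoc)
    also have "-1 * (a / (c - 1)) = a / (1 - c)" using c by (simp add: field_simps)
    finally show ?thesis .
  qed
  note pos = pochhammer_pos_ge_2[OF n(1)]
  show "0 < (-1) ^ n * meixner n \<beta> c 0"
    unfolding meixner_at_0 sgn using pos c by simp
  have "0 < 1 - real n * (1 / c - 1) / \<beta>"
  proof -
    have "0 \<le> real n * (1 / c - 1)" using c by simp
    hence "real n * (1 / c - 1) / \<beta> \<le> 0" using beta by (intro divide_nonneg_nonpos) auto
    thus ?thesis by simp
  qed
  thus "0 < (-1) ^ n * meixner n \<beta> c 1"
    unfolding meixner_at_1 mult.assoc sgn using pos c by simp
  \<comment> \<open>Since \<open>\<beta>\<close> is negative, this is exactly the lower bound on
    \<open>n\<close>.\<close>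
  have "1 + real n * (1 - c) / \<beta> < 0" using n(2) beta c by (simp add: field_simps)
  thus "(-1) ^ n * meixner n \<beta> c (- \<beta> - 1) < 0"
    unfolding meixner_at_neg_minus_1[OF c nz] mult.assoc sgn using pos c
    by (simp add: mult_less_0_iff zero_less_mult_iff)
qed

text \<open>The factor \<open>s\<close> enters the product only as a square, so sign facts
  normalized by powers of -1 can be fed in directly.\<close>

lemma meixner_zero_between:
  assumes "a < b" "(s * meixner n \<beta> c a) * (s * meixner n \<beta> c b) < 0"
  shows "\<exists>x. a < x \<and> x < b \<and> meixner n \<beta> c x = 0"
proof -
  have "s\<^sup>2 * (meixner n \<beta> c a * meixner n \<beta> c b) < 0"
    using assms(2) by (simp add: power2_eq_square mult_ac)
  hence "meixner n \<beta> c a * meixner n \<beta> c b < 0"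
    by (metis mult_less_0_iff not_less zero_le_power2)
  thus ?thesis using poly_IVT[OF assms(1), of "meixner_poly n \<beta> c"] c by (auto simp: poly_meixner_poly)
qed

section \<open>Location of the zeros, and signs of the preceding polynomial at them\<close>

context
  fixes n :: nat and xn :: "nat \<Rightarrow> real"
  assumes n: "2 \<le> n" "\<beta> / (c - 1) < real n"
    and xn_mono: "strict_mono_on {1..n} xn"
    and xn_zeros: "{x. meixner n \<beta> c x = 0} = xn ` {1..n}"
begin

lemma zeros_less: "i \<in> {1..n} \<Longrightarrow> j \<in> {1..n} \<Longrightarrow> i < j \<Longrightarrow> xn i < xn j"
  using strict_mono_onD[OF xn_mono] by blast

lemma meixner_poly_factorization: "meixner_poly n \<beta> c = (\<Prod>i\<in>{1..n}. [:- xn i, 1:])"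
proof (rule monic_poly_eq_prod_roots)
  show "inj_on xn {1..n}" using xn_mono by (rule strict_mono_on_imp_inj_on)
qed (use meixner_poly_monic[OF c pochhammer_nonzero] xn_zeros c in \<open>auto simp: poly_meixner_poly\<close>)

lemma exists_nat_above_zeros: "\<exists>K\<ge>2. \<forall>i\<in>{1..n}. xn i < real K"
proof -
  obtain K where K: "Max (xn ` {1..n}) < real K" using reals_Archimedean2 by blast
  have "xn i < real (max 2 K)" if "i \<in> {1..n}" for i
  proof -
    have "xn i \<le> Max (xn ` {1..n})" using that by (intro Max_ge) auto
    thus ?thesis using K by simp
  qed
  thus ?thesis by (intro exI[of _ "max 2 K"]) auto
qed

lemma meixner_zero_location:
  shows "0 < xn 1" "xn 1 < - \<beta> - 1" "- \<beta> - 1 < xn 2" "xn 2 < 1"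
    and "\<And>j. j \<in> {3..n} \<Longrightarrow> 2 < xn j"
proof -
  note sg = meixner_signs[OF n]
  obtain y where y: "0 < y" "y < - \<beta> - 1" "meixner n \<beta> c y = 0"
    using meixner_zero_between[of 0 "- \<beta> - 1" "(-1) ^ n" n] sg beta
    by (auto simp: mult_less_0_iff)
  obtain z where z: "- \<beta> - 1 < z" "z < 1" "meixner n \<beta> c z = 0"
    using meixner_zero_between[of "- \<beta> - 1" 1 "(-1) ^ n" n] sg beta
    by (auto simp: mult_less_0_iff)
  obtain i where i: "i \<in> {1..n}" "y = xn i" using y(3) xn_zeros by blast
  obtain k where k: "k \<in> {1..n}" "z = xn k" using z(3) xn_zeros by blast
  have ik: "i \<noteq> k" using i k y z by auto
  have far: "2 < xn j" if j: "j \<in> {1..n}" "j \<noteq> i" "j \<noteq> k" for j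
  proof (rule ccontr)
    assume "\<not> 2 < xn j"
    define R where "R = (\<Prod>l\<in>{1..n} - {i, k, j}. [:- xn l, 1:])"
    have split: "{1..n} = insert i (insert k (insert j ({1..n} - {i, k, j})))" using i k j by auto
    have card: "card ({1..n} - {i, k, j}) = n - 3"
      using i k j ik by (subst card_Diff_subset) auto
    \<comment> \<open>Three distinct indices force \<open>3 \<le> n\<close>, so the natural
      subtraction \<open>n - 3\<close> is exact and \<open>q\<close> has degree below
      \<open>n\<close>.\<close>
    have "card {i, k, j} \<le> card {1..n}" using i k j by (intro card_mono) auto
    hence "3 \<le> n" using ik j by simp
    have M: "meixner_poly n \<beta> c = [:- xn i, 1:] * ([:- xn k, 1:] * ([:- xn j, 1:] * R))"
      unfolding meixner_poly_factorization R_def using ik j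
      by (subst split) (simp del: mult_pCons_left)
    define q where "q = [:0, 1:] * ([:-1, 1:] * R)"
    have "degree q \<le> 1 + (1 + (n - 3))"
      unfolding q_def R_def
      by (intro order.trans[OF degree_mult_le] add_mono, unfold degree_prod_linear card) simp_all
    hence "degree q < n" using \<open>3 \<le> n\<close> by simp
    hence "meixner_functional \<beta> c (meixner_poly n \<beta> c * q) = 0"
      by (subst meixner_orthogonality[OF c pochhammer_nonzero]) (auto simp: coeff_eq_0)
    moreover have "0 < meixner_functional \<beta> c (meixner_poly n \<beta> c * q)"
    proof -
      obtain K where K: "2 \<le> K" "\<And>l. l \<in> {1..n} \<Longrightarrow> xn l < real K"
        using exists_nat_above_zeros by blast
      have eq: "poly (meixner_poly n \<beta> c * q) x
          = (x * (x - 1)) * ((x - xn i) * (x - xn k) * (x - xn j)) * (poly R x)\<^sup>2" for x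
        unfolding M q_def by (simp del: mult_pCons_left add: power2_eq_square)
      \<comment> \<open>With all three unsquared zeros at most 2, the cubic factor is nonnegative at
        every integer from 2 on.\<close>
      have xj: "xn j \<le> 2" "xn i \<le> 2" "xn k \<le> 2" using \<open>\<not> 2 < xn j\<close> i y k z beta by auto
      show ?thesis
      proof (rule meixner_functional_pos_off_1[OF _ _ _ K(1)])
        show "0 \<le> poly (meixner_poly n \<beta> c * q) (real l)" if "2 \<le> l" for l
        proof -
          have "2 \<le> real l" using that by simp
          thus ?thesis unfolding eq using xj by (intro mult_nonneg_nonneg) auto
        qed
        have "0 < poly R (real K)" unfolding R_def using K(2) by (auto simp: poly_prod intro!: prod_pos)
        thus "0 < poly (meixner_poly n \<beta> c * q) (real K)"
          unfolding eq using K(1) K(2)[OF i(1)] K(2)[OF k(1)] K(2)[OF j(1)]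
          by (intro mult_pos_pos zero_less_power) auto
      qed (unfold eq, simp_all)
    qed
    ultimately show False by simp
  qed
  \<comment> \<open>All zeros other than \<open>y\<close> and \<open>z\<close> exceed 2, so a zero
    before \<open>y\<close> could only be \<open>z\<close>, which lies to its right.\<close>
  have "i = 1"
  proof (rule ccontr)
    assume "i \<noteq> 1"
    hence "xn 1 < xn i" using i by (intro zeros_less) auto
    moreover have "1 \<in> {1..n}" using n by auto
    ultimately show False using far[of 1] i y k z beta \<open>i \<noteq> 1\<close> by (cases "k = 1") auto
  qed
  moreover have "k = 2"
  proof (rule ccontr)
    assume "k \<noteq> 2"
    hence "2 < k" using ik \<open>i = 1\<close> k by auto
    hence "xn 2 < xn k" using k by (intro zeros_less) auto
    moreover have "2 \<in> {1..n}" using n by auto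
    ultimately show False using far[of 2] z k beta \<open>i = 1\<close> \<open>k \<noteq> 2\<close> by auto
  qed
  ultimately show "0 < xn 1" "xn 1 < - \<beta> - 1" "- \<beta> - 1 < xn 2" "xn 2 < 1"
    and "\<And>j. j \<in> {3..n} \<Longrightarrow> 2 < xn j"
    using i k y z far by auto
qed

lemma meixner_pred_signs:
  assumes m: "n = Suc m" "2 \<le> m"
  shows "(-1) ^ n * meixner m \<beta> c (xn 1) < 0" "(-1) ^ n * meixner m \<beta> c (xn 2) < 0"
    and "\<And>j. j \<in> {3..n} \<Longrightarrow> 0 < (-1) ^ (n - j) * meixner m \<beta> c (xn j)"
proof -
  note loc = meixner_zero_location
  note norm = meixner_norm_pos[OF m(2)]
  obtain K where K: "2 \<le> K" "\<And>l. l \<in> {1..n} \<Longrightarrow> xn l < real K"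
    using exists_nat_above_zeros by blast
  have x12: "xn 1 < 1" "0 < xn 2" using loc beta by auto
  \<comment> \<open>In the quadrature identity the functional and the norm are both positive, so
    \<open>meixner m \<beta> c t\<close> inherits the sign of \<open>poly q t\<close>.\<close>
  have sign: "0 < s * meixner m \<beta> c t"
    if P: "meixner_poly n \<beta> c = [:- t, 1:] * P" and "degree q \<le> n"
      and L: "0 < meixner_functional \<beta> c (P * q)" and q: "0 < s * poly q t" for s t P q
  proof -
    have "meixner_functional \<beta> c (P * q) * meixner m \<beta> c t = poly q t * meixner_norm m \<beta> c"
      using that unfolding m by (intro meixner_quadrature[OF c pochhammer_nonzero])
    hence "(s * meixner m \<beta> c t) * meixner_functional \<beta> c (P * q) = (s * poly q t) * meixner_norm m \<beta> c"
      by (simp add: mult_ac)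
    moreover have "0 < (s * poly q t) * meixner_norm m \<beta> c" using q norm by (rule mult_pos_pos)
    ultimately show ?thesis using L by (metis zero_less_mult_pos2)
  qed

  define R where "R = (\<Prod>l\<in>{3..n}. [:- xn l, 1:])"
  have "{1..n} = insert 1 (insert 2 {3..n})" using m by auto
  hence M: "meixner_poly n \<beta> c = [:- xn 1, 1:] * ([:- xn 2, 1:] * R)"
    unfolding meixner_poly_factorization R_def by (simp del: mult_pCons_left)
  have degR: "degree ([:-1, 1:] * R) \<le> n"
    by (rule order.trans[OF degree_mult_le])
       (unfold R_def degree_prod_linear, use m in simp)
  \<comment> \<open>Used with \<open>y\<close> being either of the first two zeros, both in the unit
    interval: \<open>(x - y) * (x - 1)\<close> is positive at 0, zero at 1 and positive from 2
    on.\<close>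
  have L: "0 < meixner_functional \<beta> c ([:- y, 1:] * R * ([:-1, 1:] * R))" if y: "0 < y" "y < 1" for y
  proof -
    have eq: "poly ([:- y, 1:] * R * ([:-1, 1:] * R)) x = (x - y) * (x - 1) * (poly R x)\<^sup>2" for x
      by (simp del: mult_pCons_left add: power2_eq_square)
    show ?thesis
    proof (rule meixner_functional_pos_off_1[OF _ _ _ K(1)])
      show "0 \<le> poly ([:- y, 1:] * R * ([:-1, 1:] * R)) (real l)" if "2 \<le> l" for l
        unfolding eq using that y by (intro mult_nonneg_nonneg) auto
      have "0 < poly R (real K)" unfolding R_def using K(2) by (auto simp: poly_prod intro!: prod_pos)
      thus "0 < poly ([:- y, 1:] * R * ([:-1, 1:] * R)) (real K)"
        unfolding eq using K(1) y by (intro mult_pos_pos zero_less_power) auto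
    qed (unfold eq, use y in simp_all)
  qed
  \<comment> \<open>The product \<open>R\<close> has \<open>n - 2\<close> negative factors at
    \<open>t\<close>, the same parity as \<open>n\<close>; the factor \<open>t - 1\<close> adds one
    more sign.\<close>
  have Rsign: "0 < - ((-1) ^ n) * poly ([:-1, 1:] * R) t" if "t < 1" for t
  proof -
    have "0 < (-1) ^ card {3..n} * (\<Prod>l\<in>{3..n}. t - xn l)"
      using loc(5) that by (intro prod_diff_sign) fastforce
    moreover have "(-1) ^ card {3..n} = ((-1) ^ n :: real)"
    proof -
      have "n = card {3..n} + 2" using m by simp
      thus ?thesis by (metis power_add power2_minus one_power2 mult_1_right)
    qed
    moreover have "poly R t = (\<Prod>l\<in>{3..n}. t - xn l)" by (simp add: R_def poly_prod)
    ultimately have "0 < (1 - t) * ((-1) ^ n * poly R t)" using that by simp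
    thus ?thesis by (simp add: algebra_simps)
  qed
  have "0 < - ((-1) ^ n) * meixner m \<beta> c (xn 1)"
    using M degR L[OF x12(2) loc(4)] Rsign[OF x12(1)] by (rule sign)
  thus "(-1) ^ n * meixner m \<beta> c (xn 1) < 0" by simp
  have "meixner_poly n \<beta> c = [:- xn 2, 1:] * ([:- xn 1, 1:] * R)"
    unfolding M by (simp only: mult_ac)
  hence "0 < - ((-1) ^ n) * meixner m \<beta> c (xn 2)"
    using degR L[OF loc(1) x12(1)] Rsign[OF loc(4)] by (rule sign)
  thus "(-1) ^ n * meixner m \<beta> c (xn 2) < 0" by simp

  fix j assume j: "j \<in> {3..n}"
  define S where "S = (\<Prod>l\<in>{3..n} - {j}. [:- xn l, 1:])"
  define P where "P = [:- xn 1, 1:] * ([:- xn 2, 1:] * S)"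
  define q where "q = [:0, 1:] * ([:-1, 1:] * S)"
  have "R = [:- xn j, 1:] * S"
    unfolding R_def S_def using j by (intro prod.remove) auto
  hence "meixner_poly n \<beta> c = [:- xn j, 1:] * P"
    unfolding M P_def by (simp only: mult_ac)
  moreover have "degree q \<le> n"
  proof -
    have "degree q \<le> 1 + (1 + (n - 3))"
      unfolding q_def S_def using j
      by (intro order.trans[OF degree_mult_le] add_mono) (simp_all add: degree_prod_linear)
    thus ?thesis using m by simp
  qed
  moreover have "0 < meixner_functional \<beta> c (P * q)"
  proof -
    have eq: "poly (P * q) x = (x * (x - 1)) * ((x - xn 1) * (x - xn 2)) * (poly S x)\<^sup>2" for x
      unfolding P_def q_def by (simp del: mult_pCons_left add: power2_eq_square)
    show ?thesis
    proof (rule meixner_functional_pos_off_1[OF _ _ _ K(1)])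
      show "0 \<le> poly (P * q) (real l)" if "2 \<le> l" for l
      proof -
        have "2 \<le> real l" using that by simp
        thus ?thesis unfolding eq using x12 loc(4) by (intro mult_nonneg_nonneg) auto
      qed
      have "2 \<le> real K" using K(1) by simp
      moreover have "0 < poly S (real K)" unfolding S_def using K(2) by (auto simp: poly_prod intro!: prod_pos)
      ultimately show "0 < poly (P * q) (real K)"
        unfolding eq using x12 loc(4) by (intro mult_pos_pos zero_less_power) auto
    qed (unfold eq, simp_all)
  qed
  moreover have "0 < (-1) ^ (n - j) * poly q (xn j)"
  proof -
    have "poly S (xn j) = (\<Prod>l\<in>{3..n} - {j}. xn j - xn l)"
      by (simp add: S_def poly_prod)
    \<comment> \<open>Factors with \<open>l < j\<close> are positive, while the \<open>n - j\<close>
      factors with \<open>l > j\<close> are negative.\<close>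
    also have "{3..n} - {j} = {3..<j} \<union> {j<..n}" using j by auto
    also have "(\<Prod>l\<in>\<dots>. xn j - xn l)
        = (\<Prod>l\<in>{3..<j}. xn j - xn l) * (\<Prod>l\<in>{j<..n}. xn j - xn l)"
      by (rule prod.union_disjoint) auto
    finally have "poly S (xn j) = (\<Prod>l\<in>{3..<j}. xn j - xn l) * (\<Prod>l\<in>{j<..n}. xn j - xn l)" .
    moreover have "0 < (\<Prod>l\<in>{3..<j}. xn j - xn l)"
      using j zeros_less by (intro prod_pos) auto
    moreover have "0 < (-1) ^ (n - j) * (\<Prod>l\<in>{j<..n}. xn j - xn l)"
      using prod_diff_sign[of "{j<..n}" "xn j" xn] j zeros_less by auto
    ultimately have "0 < (-1) ^ (n - j) * poly S (xn j)"
      by (metis mult.left_commute mult_pos_pos)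
    moreover have "0 < xn j * (xn j - 1)" using loc(5)[OF j] by simp
    ultimately have "0 < (xn j * (xn j - 1)) * ((-1) ^ (n - j) * poly S (xn j))" by (rule mult_pos_pos[rotated])
    moreover have "poly q (xn j) = xn j * (xn j - 1) * poly S (xn j)"
      unfolding q_def by (simp del: mult_pCons_left)
    ultimately show ?thesis by (simp add: mult_ac)
  qed
  ultimately show "0 < (-1) ^ (n - j) * meixner m \<beta> c (xn j)" by (rule sign)
qed

end

end

section \<open>Interlacing\<close>

theorem theorem4p6:
  fixes \<beta> c :: real and n :: nat and xn xm :: "nat \<Rightarrow> real"
  assumes beta: "-2 < \<beta>" "\<beta> < -1"
    and c: "0 < c" "c < 1"
    and n: "n \<ge> 3" "real n - 1 > \<beta> / (c - 1)"
    and no_common: "\<not> (\<exists>x. meixner n \<beta> c x = 0 \<and> meixner (n - 1) \<beta> c x = 0)"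
    and xn_mono: "strict_mono_on {1..n} xn"
    and xn_zeros: "{x. meixner n \<beta> c x = 0} = xn ` {1..n}"
    and xm_mono: "strict_mono_on {1..n-1} xm"
    and xm_zeros: "{x. meixner (n - 1) \<beta> c x = 0} = xm ` {1..n-1}"
  shows "0 < xn 1 \<and> xn 1 < xm 1 \<and> xm 1 < -\<beta> - 1 \<and> -\<beta> - 1 < xm 2 \<and>
         xm 2 < xn 2 \<and> xn 2 < -\<beta> \<and> -\<beta> < xn 3 \<and>
         (\<forall>k\<in>{3..n-1}. xn k < xm k \<and> xm k < xn (k + 1))"
proof -
  define m where "m = n - 1"
  have m: "n = Suc m" "2 \<le> m" "\<beta> / (c - 1) < real m" using n by (auto simp: m_def)
  have n2: "2 \<le> n" "\<beta> / (c - 1) < real n" using n by auto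
  note ctxt = beta c n2 xn_mono xn_zeros
  note loc = meixner_zero_location[OF ctxt]
  note sgn = meixner_pred_signs[OF ctxt m(1,2)]
  \<comment> \<open>The sign is known with exponent \<open>m\<close>; passing to
    \<open>n = Suc m\<close> reverses it.\<close>
  have mid: "0 < (-1) ^ n * meixner m \<beta> c (- \<beta> - 1)"
    using meixner_signs(2)[OF beta c m(2,3)] unfolding m(1) by simp
  note zero = meixner_zero_between[OF beta c, where n = m]
  \<comment> \<open>The claimed intervals for the zeros of index \<open>n - 1\<close>. The first two
    meet at \<open>- \<beta> - 1\<close>, and the second ends at \<open>xn 2\<close>, so none lies
    between \<open>xn 2\<close> and \<open>xn 3\<close>.\<close>
  define lo hi where "lo = (\<lambda>k. if k = 2 then - \<beta> - 1 else xn k)"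
    and "hi = (\<lambda>k. if k = 1 then - \<beta> - 1 else if k = 2 then xn 2 else xn (k + 1))"
  have "\<exists>y. lo k < y \<and> y < hi k \<and> meixner m \<beta> c y = 0" if k: "k \<in> {1..m}" for k
  proof -
    consider "k = 1" | "k = 2" | "k \<in> {3..m}" using k by force
    thus ?thesis
    proof cases
      case 1
      thus ?thesis using zero[of "xn 1" "- \<beta> - 1" "(-1) ^ n"] loc(2) sgn(1) mid
        by (simp add: lo_def hi_def mult_less_0_iff)
    next
      case 2
      thus ?thesis using zero[of "- \<beta> - 1" "xn 2" "(-1) ^ n"] loc(3) sgn(2) mid
        by (simp add: lo_def hi_def mult_less_0_iff)
    next
      case 3
      have "xn k < xn (k + 1)" using 3 m by (intro zeros_less[OF ctxt]) auto
      moreover have "0 < (-1) ^ (n - k) * meixner m \<beta> c (xn k)" using 3 m by (intro sgn(3)) auto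
      moreover have "(-1) ^ (n - k) * meixner m \<beta> c (xn (k + 1)) < 0"
      proof -
        have "n - k = Suc (n - (k + 1))" using 3 m by auto
        moreover have "0 < (-1) ^ (n - (k + 1)) * meixner m \<beta> c (xn (k + 1))"
          using 3 m by (intro sgn(3)) auto
        ultimately show ?thesis by simp
      qed
      ultimately show ?thesis using zero[of "xn k" "xn (k + 1)" "(-1) ^ (n - k)"] 3
        by (simp add: lo_def hi_def mult_less_0_iff)
    qed
  qed
  then obtain y where y: "\<And>k. k \<in> {1..m} \<Longrightarrow> lo k < y k \<and> y k < hi k \<and> meixner m \<beta> c (y k) = 0"
    by metis
  have y_mono: "strict_mono_on {1..m} y"
  proof (rule strict_mono_onI)
    fix i j assume ij: "i \<in> {1..m}" "j \<in> {1..m}" "i < j"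
    have le: "xn a \<le> xn b" if "a \<in> {1..n}" "b \<in> {1..n}" "a \<le> b" for a b
      using zeros_less[OF ctxt that(1,2)] that(3) by (cases "a = b") auto
    \<comment> \<open>The intervals are disjoint and ordered by index, hence so are the zeros chosen
      in them.\<close>
    have "hi i \<le> lo j"
    proof -
      consider "i = 1" "j = 2" | "i = 1" "3 \<le> j" | "i = 2" "3 \<le> j" | "3 \<le> i" "3 \<le> j"
        using ij by force
      thus ?thesis
      proof cases
        case 2
        have "xn 2 \<le> xn j" using 2 ij m by (intro le) auto
        thus ?thesis using 2 loc(3) by (simp add: lo_def hi_def)
      next
        case 3
        have "xn 2 \<le> xn j" using 3 ij m by (intro le) auto
        thus ?thesis using 3 by (simp add: lo_def hi_def)
      next
        case 4
        have "xn (i + 1) \<le> xn j" using 4 ij m by (intro le) auto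
        thus ?thesis using 4 by (simp add: lo_def hi_def)
      qed (simp add: lo_def hi_def)
    qed
    thus "y i < y j" using y[OF ij(1)] y[OF ij(2)] by linarith
  qed
  \<comment> \<open>The \<open>m\<close> distinct zeros found exhaust the \<open>m\<close> given
    ones, and increasing enumerations of one set coincide.\<close>
  have "y ` {1..m} = xm ` {1..m}"
  proof (rule card_subset_eq)
    show "y ` {1..m} \<subseteq> xm ` {1..m}" using y xm_zeros by (auto simp: m_def)
    show "card (y ` {1..m}) = card (xm ` {1..m})"
      using y_mono xm_mono by (simp add: card_image strict_mono_on_imp_inj_on m_def)
  qed simp
  hence "xm k = y k" if "k \<in> {1..m}" for k
    using strict_mono_on_image_unique[OF y_mono _ _ that] xm_mono by (simp add: m_def)
  hence xm: "lo k < xm k \<and> xm k < hi k" if "k \<in> {1..m}" for k using y that by simp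
  \<comment> \<open>Here \<open>- \<beta>\<close> lies strictly between 1 and 2, which separate
    \<open>xn 2\<close> from \<open>xn 3\<close>.\<close>
  have "xn 2 < - \<beta>" "- \<beta> < xn 3" using loc(4) loc(5)[of 3] beta n by auto
  moreover have "\<forall>k\<in>{3..m}. xn k < xm k \<and> xm k < xn (k + 1)"
  proof
    fix k assume "k \<in> {3..m}"
    thus "xn k < xm k \<and> xm k < xn (k + 1)" using xm[of k] by (simp add: lo_def hi_def)
  qed
  ultimately show ?thesis
    using loc(1) xm[of 1] xm[of 2] m(2) by (simp add: lo_def hi_def m_def)
qed

end
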